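(* Let $m\ge 3$ and let $\lambda$ be a trivial coloring on $\mathrm{P}^3(m)$ with $\lambda(c)=\lambda(f)=e_1$. If $\lambda$ is 3-independent and does not have the property $(\star)$, then $m$ is even and $\lambda$ is sector-equivalent to the canonical form $\lambda_{C_4}$ with coloring sequence $\mathcal{C}_4=(\bar\alpha,\beta,\alpha,\beta,\dots,\alpha,\beta)$.
   Context: $\mathrm{P}^3(m)=[0,1]\times(m\text{-gon})$, with ceiling $c$ and floor $f$ (the two $m$-gon faces; for $m=4$ a fixed pair of opposite faces) and side faces $s_1,\dots,s_m$ in cyclic order. A coloring $\lambda$ assigns to each facet a vector of $(\mathbb{Z}_2)^3$ such that facets with nonempty common intersection get linearly independent vectors. $\lambda$ is trivial if $\lambda(c)=\lambda(f)$; it is 2-independent if $\lambda(s_1),\dots,\lambda(s_m)$ span a 2-dimensional subspace of $(\mathbb{Z}_2)^3$, and 3-independent otherwise. Fix a basis $\{e_1,\alpha,\beta\}$ of $(\mathbb{Z}_2)^3$ and put $\gamma=\alpha+\beta$, $\bar\alpha=\alpha+e_1$, $\bar\beta=\beta+e_1$, $\bar\gamma=\gamma+e_1$. A trivial coloring with $\lambda(c)=\lambda(f)=e_1$ is described by its coloring sequence $(\lambda(s_1),\dots,\lambda(s_m))$, viewed cyclically; $\lambda_{C_4}$ is the coloring with ceiling and floor colored $e_1$ and side sequence $\mathcal{C}_4$ (dots denote repetition of $\alpha,\beta$). $\lambda$ has property $(\star)$ if each of the three letters $\alpha,\beta,\gamma$ (each with or without bar) appears in its coloring sequence. Sector-equivalence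 of trivial colorings is the equivalence relation generated by: (i) $\lambda\mapsto\sigma\circ\lambda$ with $\sigma\in\mathrm{GL}(3,\mathbb{Z}_2)$ (Davis–Januszkiewicz equivalence); (ii) cyclic rotation or reversal of the order of the side faces; (iii) the following operations for $k<l$, which change only the colors of the block $s_k,s_{k+1},\dots,s_l$: $\mathrm{O}_1$: if $\lambda(s_k)=\lambda(s_l)$, reverse the block. $\mathrm{O}_{21}$: if $\lambda(s_k)=\lambda(s_l)+\lambda(c)$, apply to each entry of the block the linear map that is the identity on $\mathrm{Span}\{\lambda(c),\lambda(s_k)\}$ and sends each $v$ outside it to $v+\lambda(c)$. $\mathrm{O}_{22}$: if $\lambda(s_k)=\lambda(s_l)+\lambda(c)$, choose $w$ with $\{\lambda(c),\lambda(s_k),w\}$ a basis, reverse the block, and apply to each entry the linear map $\lambda(c)\mapsto\lambda(c)$, $\lambda(s_k)\mapsto\lambda(s_l)$, $w\mapsto w$. $\mathrm{O}_{32}$: if $\lambda(s_k),\lambda(s_l),\lambda(c)$ are linearly independent, reverse the block and apply to each entry the linear map fixing $\lambda(c)$ and interchanging $\lambda(s_k)$ and $\lambda(s_l)$. *)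

theory Defs
  imports "HOL-Analysis.Analysis" "HOL-Library.Z2"
begin

text \<open>
  The vector space $(\mathbb{Z}_2)^3$ is \<^typ>\<open>bit ^ 3\<close>; its linear algebra is that of the
  \<open>vec\<close> interpretation. The side faces are numbered from \<open>0\<close> to \<open>m - 1\<close>.
\<close>

datatype facet = Ceiling | Floor | Side nat

type_synonym coloring = "facet \<Rightarrow> bit ^ 3"

definition facets :: "nat \<Rightarrow> facet set" where
  "facets m = {Ceiling, Floor} \<union> Side ` {..<m}"

definition corner :: "nat \<Rightarrow> nat \<Rightarrow> complex" where
  "corner m i = cis (2 * pi * real i / real m)"

definition polygon :: "nat \<Rightarrow> complex set" where
  "polygon m = convex hull (corner m ` {..<m})"

text \<open>The facets as subsets of the prism \<open>{0..1} \<times> polygon m\<close> over the regular \<open>m\<close>-gon.\<close>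

fun realize :: "nat \<Rightarrow> facet \<Rightarrow> (real \<times> complex) set" where
  "realize m Ceiling = {1} \<times> polygon m"
| "realize m Floor = {0} \<times> polygon m"
| "realize m (Side i) = {0..1} \<times> closed_segment (corner m i) (corner m (Suc i))"

text \<open>
  Linear independence of the family of colors indexed by \<open>F\<close>: two facets in \<open>F\<close>
  with the same color make the family dependent, whence the injectivity.
\<close>

definition independent_colors :: "coloring \<Rightarrow> facet set \<Rightarrow> bool" where
  "independent_colors col F \<longleftrightarrow> inj_on col F \<and> vec.independent (col ` F)"

text \<open>Only the values of a coloring on \<open>facets m\<close> are meaningful.\<close>

definition is_coloring :: "nat \<Rightarrow> coloring \<Rightarrow> bool" where
  "is_coloring m col \<longleftrightarrow>
     (\<forall>F \<subseteq> facets m. (\<Inter>x\<in>F. realize m x) \<noteq> {} \<longrightarrow> independent_colors col F)"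

definition trivial_coloring :: "nat \<Rightarrow> coloring \<Rightarrow> bool" where
  "trivial_coloring m col \<longleftrightarrow> is_coloring m col \<and> col Ceiling = col Floor"

definition two_independent :: "nat \<Rightarrow> coloring \<Rightarrow> bool" where
  "two_independent m col \<longleftrightarrow> vec.dim (vec.span (col ` Side ` {..<m})) = 2"

definition three_independent :: "nat \<Rightarrow> coloring \<Rightarrow> bool" where
  "three_independent m col \<longleftrightarrow> \<not> two_independent m col"

definition is_basis :: "bit ^ 3 \<Rightarrow> bit ^ 3 \<Rightarrow> bit ^ 3 \<Rightarrow> bool" where
  "is_basis u v w \<longleftrightarrow>
     distinct [u, v, w] \<and> vec.independent {u, v, w} \<and> vec.span {u, v, w} = UNIV"

definition property_star :: "bit ^ 3 \<Rightarrow> bit ^ 3 \<Rightarrow> bit ^ 3 \<Rightarrow> nat \<Rightarrow> coloring \<Rightarrow> bool" where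
  "property_star e1 \<alpha> \<beta> m col \<longleftrightarrow>
     (\<forall>x \<in> {\<alpha>, \<beta>, \<alpha> + \<beta>}. \<exists>i<m. col (Side i) = x \<or> col (Side i) = x + e1)"

text \<open>
  \<open>recolor_sides m col g col'\<close>: the coloring \<open>col'\<close> of the prism has the ceiling and floor colors
  of \<open>col\<close> and side colors \<open>g 0, \<dots>, g (m - 1)\<close>; its values outside \<open>facets m\<close> are arbitrary.
\<close>

definition recolor_sides :: "nat \<Rightarrow> coloring \<Rightarrow> (nat \<Rightarrow> bit ^ 3) \<Rightarrow> coloring \<Rightarrow> bool" where
  "recolor_sides m col g col' \<longleftrightarrow>
     col' Ceiling = col Ceiling \<and> col' Floor = col Floor \<and> (\<forall>i<m. col' (Side i) = g i)"

definition change_block ::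
  "nat \<Rightarrow> nat \<Rightarrow> nat \<Rightarrow> coloring \<Rightarrow> (nat \<Rightarrow> bit ^ 3) \<Rightarrow> coloring \<Rightarrow> bool" where
  "change_block m k l col g col' \<longleftrightarrow>
     k < l \<and> l < m \<and>
     recolor_sides m col (\<lambda>i. if k \<le> i \<and> i \<le> l then g i else col (Side i)) col'"

text \<open>
  In the rules for the block operations, \<open>col (Side (k + l - i))\<close> is the entry at position \<open>i\<close>
  of the reversed block. In \<open>O22\<close> and \<open>O32\<close> the linear map \<open>T\<close> is determined by its values on
  a basis.
\<close>

inductive sector_move :: "nat \<Rightarrow> coloring \<Rightarrow> coloring \<Rightarrow> bool" for m col where
  DJ: "Vector_Spaces.linear (*s) (*s) \<sigma> \<Longrightarrow> bij \<sigma> \<Longrightarrow>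
       (\<forall>x \<in> facets m. col' x = \<sigma> (col x)) \<Longrightarrow> sector_move m col col'"
| rotation: "recolor_sides m col (\<lambda>i. col (Side ((i + r) mod m))) col' \<Longrightarrow> sector_move m col col'"
| reversal: "recolor_sides m col (\<lambda>i. col (Side (m - 1 - i))) col' \<Longrightarrow> sector_move m col col'"
| O1: "col (Side k) = col (Side l) \<Longrightarrow>
       change_block m k l col (\<lambda>i. col (Side (k + l - i))) col' \<Longrightarrow> sector_move m col col'"
| O21: "col (Side k) = col (Side l) + col Ceiling \<Longrightarrow>
       change_block m k l col
         (\<lambda>i. if col (Side i) \<in> vec.span {col Ceiling, col (Side k)} then col (Side i)
              else col (Side i) + col Ceiling) col' \<Longrightarrow> sector_move m col col'"
| O22: "col (Side k) = col (Side l) + col Ceiling \<Longrightarrow>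
       is_basis (col Ceiling) (col (Side k)) w \<Longrightarrow>
       Vector_Spaces.linear (*s) (*s) T \<Longrightarrow>
       T (col Ceiling) = col Ceiling \<Longrightarrow> T (col (Side k)) = col (Side l) \<Longrightarrow> T w = w \<Longrightarrow>
       change_block m k l col (\<lambda>i. T (col (Side (k + l - i)))) col' \<Longrightarrow> sector_move m col col'"
| O32: "independent_colors col {Side k, Side l, Ceiling} \<Longrightarrow>
       Vector_Spaces.linear (*s) (*s) T \<Longrightarrow>
       T (col Ceiling) = col Ceiling \<Longrightarrow>
       T (col (Side k)) = col (Side l) \<Longrightarrow> T (col (Side l)) = col (Side k) \<Longrightarrow>
       change_block m k l col (\<lambda>i. T (col (Side (k + l - i)))) col' \<Longrightarrow> sector_move m col col'"

definition sector_step :: "nat \<Rightarrow> coloring \<Rightarrow> coloring \<Rightarrow> bool" where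
  "sector_step m col col' \<longleftrightarrow>
     trivial_coloring m col \<and> trivial_coloring m col' \<and> sector_move m col col'"

definition sector_equivalent :: "nat \<Rightarrow> coloring \<Rightarrow> coloring \<Rightarrow> bool" where
  "sector_equivalent m = equivclp (sector_step m)"

text \<open>
  For even \<open>m\<close> the side sequence of \<open>coloring_C4\<close> is
  \<open>\<alpha> + e1, \<beta>, \<alpha>, \<beta>, \<dots>, \<alpha>, \<beta>\<close>.
\<close>

fun coloring_C4 :: "bit ^ 3 \<Rightarrow> bit ^ 3 \<Rightarrow> bit ^ 3 \<Rightarrow> coloring" where
  "coloring_C4 e1 \<alpha> \<beta> (Side i) = (if i = 0 then \<alpha> + e1 else if even i then \<alpha> else \<beta>)"
| "coloring_C4 e1 \<alpha> \<beta> _ = e1"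

end

theory Submission
  imports Defs
begin

text \<open>
  Modulo \<open>e1\<close> adjacent sides have different nonzero letters, and only two letters occur, so they
  alternate around the polygon: \<open>m\<close> is even and, after a linear change of colors, the even sides
  carry \<open>\<alpha>\<close> and the odd sides \<open>\<beta>\<close>, each possibly barred. A coloring is then a bit
  sequence (the bars), and 3-independence says that the bars are not constant on one of the two
  parity classes. The operation \<open>O\<^sub>2\<^sub>1\<close> between two sides of equal parity but different bars flips
  all bars of the other parity between them. Hence, as soon as the bars are not constant on one
  parity class, those of the other class can be prescribed arbitrarily. Alternating between
  the two classes, one makes the odd bars nonconstant, prescribes the even bars of
  \<open>\<lambda>\<^bsub>C\<^sub>4\<^esub>\<close>, which are not constant, and finally clears the odd bars.
\<close>

section \<open>Linear algebra over the two-element field\<close>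

lemma add_self_bit_vec [simp]: "(v :: bit ^ 'n) + v = 0"
  by (simp add: vec_eq_iff)

lemma add_self_left_bit_vec [simp]: "(v :: bit ^ 'n) + (v + w) = w"
  by (simp add: add.assoc [symmetric])

lemma double_bit_vec [simp]: "2 * (v :: bit ^ 'n) = 0"
  by (simp add: mult_2)

lemma diff_bit_vec [simp]: "(v :: bit ^ 'n) - w = v + w"
  by (simp add: vec_eq_iff)

lemma add_eq_iff_bit_vec: "(u :: bit ^ 'n) + v = w \<longleftrightarrow> u = v + w"
  by (metis add_self_left_bit_vec add.commute)

lemma ex_bit: "(\<exists>k :: bit. P k) \<longleftrightarrow> P 0 \<or> P 1"
  by (metis bit_not_zero_iff)

lemma span_pair_bit_vec: "vec.span {a, b :: bit ^ 'n} = {0, a, b, a + b}"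
  by (auto simp: vec.span_breakdown_eq ex_bit add_eq_iff_bit_vec add.commute)

lemma span_triple_bit_vec:
  "vec.span {a, b, c :: bit ^ 'n} = {0, a, b, c, a + b, a + c, b + c, a + b + c}"
  by (auto simp: vec.span_breakdown_eq ex_bit add_eq_iff_bit_vec ac_simps)

text \<open>A pair spans only four vectors, so independence of a triple becomes a finite list of
  inequations that simplification can handle.\<close>

lemma independent_triple_bit_vec:
  fixes a b c :: "bit ^ 'n"
  shows "distinct [a, b, c] \<and> vec.independent {a, b, c} \<longleftrightarrow>
    b \<noteq> 0 \<and> a \<notin> {0, b} \<and> c \<notin> {0, a, b, a + b}"
proof -
  have "{a, b, c} = {c, a, b}" by auto
  then show ?thesis
    by (auto simp: vec.independent_insert span_pair_bit_vec vec.span_singleton ex_bit)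
qed

section \<open>Which facets of the prism meet, and independence of their colors\<close>

lemma closed_segment_corner_disjoint:
  assumes "i + 2 \<le> j" "j + 2 \<le> m + i"
  shows "closed_segment (corner m i) (corner m (Suc i)) \<inter>
    closed_segment (corner m j) (corner m (Suc j)) = {}"
proof -
  define t where "t = pi / real m"
  \<comment> \<open>The linear functional \<open>f\<close> has the constant value \<open>cos t\<close> on the first edge and is smaller
    at all corners outside that edge.\<close>
  define f where "f z = z \<bullet> cis ((2 * real i + 1) * t)" for z
  have m: "m > 0" "m \<ge> 2" using assms by auto
  have t: "t > 0" "real m * t = pi" using m by (auto simp: t_def)
  have f: "f (corner m k) = cos ((2 * (real k - real i) - 1) * t)" for k
  proof -
    have "f (corner m k) = cos (2 * pi * real k / real m - (2 * real i + 1) * t)"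
      by (simp add: f_def corner_def inner_complex_def cos_diff)
    also have "2 * pi * real k / real m - (2 * real i + 1) * t = (2 * (real k - real i) - 1) * t"
      using m by (simp add: t_def divide_simps) (simp add: algebra_simps)
    finally show ?thesis .
  qed
  have less: "f (corner m k) < cos t" if "i + 2 \<le> k" "k < m + i" for k
  proof -
    define s where "s = (2 * (real k - real i) - 1) * t"
    \<comment> \<open>Here \<open>k\<close> runs from \<open>i + 2\<close> to
      \<open>m + i - 1\<close>, which keeps the angle \<open>s\<close> at distance at least
      \<open>3 * t\<close> from both ends of the interval from 0 to \<open>2 * pi\<close>.\<close>
    have "2 * (real k - real i) - 1 \<ge> 3" "2 * (real k - real i) - 1 \<le> 2 * real m - 3"
      using of_nat_mono[of "i + 2" k, where 'a = real] of_nat_mono[of "k + 1" "m + i", where 'a = real] that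
      by auto
    then have "3 * t \<le> s" "s \<le> (2 * real m - 3) * t"
      unfolding s_def using t by (auto intro: mult_right_mono)
    moreover have "(2 * real m - 3) * t = 2 * pi - 3 * t"
      using t(2) by (simp add: algebra_simps)
    ultimately have "s \<le> 2 * pi - 3 * t" by simp
    with \<open>3 * t \<le> s\<close> have s: "t < s" "s < 2 * pi - t" using t(1) by linarith+
    have "cos s < cos t"
    proof (cases "s \<le> pi")
      case True
      then show ?thesis using s(1) t(1) by (intro cos_monotone_0_pi) linarith+
    next
      case False
      then have "cos (2 * pi - s) < cos t" using s t(1) by (intro cos_monotone_0_pi) linarith+
      then show ?thesis by (simp add: cos_diff)
    qed
    then show ?thesis by (simp add: f s_def)
  qed
  have comb: "f ((1 - u) *\<^sub>R a + u *\<^sub>R b) = (1 - u) * f a + u * f b" for u a b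
    by (simp add: f_def inner_add_left)
  have "f z = cos t" if "z \<in> closed_segment (corner m i) (corner m (Suc i))" for z
  proof -
    obtain u where "f z = (1 - u) * f (corner m i) + u * f (corner m (Suc i))"
      using \<open>z \<in> _\<close> by (auto simp: in_segment comb)
    then show ?thesis by (simp add: f algebra_simps)
  qed
  moreover have "f z < cos t" if "z \<in> closed_segment (corner m j) (corner m (Suc j))" for z
  proof -
    obtain u where u: "0 \<le> u" "u \<le> 1" "f z = (1 - u) * f (corner m j) + u * f (corner m (Suc j))"
      using \<open>z \<in> _\<close> by (auto simp: in_segment comb)
    \<comment> \<open>Both endpoints \<open>j\<close> and \<open>Suc j\<close> are in the range of
      \<open>less\<close>, and a strict upper bound passes to convex combinations.\<close>
    show ?thesis
      unfolding u(3) using u(1,2) assms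
      by (intro convex_bound_lt less) auto
  qed
  ultimately show ?thesis by fastforce
qed


lemma independent_colors_triple:
  assumes "distinct [p, q, r]"
  shows "independent_colors col {p, q, r} \<longleftrightarrow>
    distinct [col p, col q, col r] \<and> vec.independent {col p, col q, col r}"
  using assms by (auto simp: independent_colors_def)

lemma independent_colors_mono:
  "independent_colors col G \<Longrightarrow> F \<subseteq> G \<Longrightarrow> independent_colors col F"
  unfolding independent_colors_def by (meson image_mono inj_on_subset vec.independent_mono)

text \<open>Distinct indices of equal parity differ by at least 2; as \<open>m\<close> is even, the
  gap the other way around the polygon is at least 2 as well.\<close>

lemma realize_Side_disjoint:
  assumes "even m" "i < m" "j < m" "i \<noteq> j" "even i \<longleftrightarrow> even j"
  shows "realize m (Side i) \<inter> realize m (Side j) = {}"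
proof -
  have *: "closed_segment (corner m i) (corner m (Suc i)) \<inter>
      closed_segment (corner m j) (corner m (Suc j)) = {}"
    if "i < j" "j < m" "even i \<longleftrightarrow> even j" for i j
  proof (rule closed_segment_corner_disjoint)
    show "i + 2 \<le> j" using that by presburger
    show "j + 2 \<le> m + i" using that \<open>even m\<close> by presburger
  qed
  have "closed_segment (corner m i) (corner m (Suc i)) \<inter>
      closed_segment (corner m j) (corner m (Suc j)) = {}"
    using *[of i j] *[of j i] assms by (cases i j rule: linorder_cases) auto
  then show ?thesis by auto
qed

text \<open>The three facets share the top vertex over the corner common to the two sides;
  \<open>mod\<close> makes the last side a neighbor of side 0.\<close>

lemma adjacent_facets_meet:
  assumes "i < m"
  shows "realize m Ceiling \<inter> realize m (Side i) \<inter> realize m (Side (Suc i mod m)) \<noteq> {}"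
proof -
  have "corner m m = corner m 0"
    using assms by (simp add: corner_def cis_2pi)
  then have c: "corner m (Suc i mod m) = corner m (Suc i)"
    using assms by (cases "Suc i = m") auto
  have "corner m (Suc i mod m) \<in> polygon m"
    unfolding polygon_def using assms by (intro hull_inc) auto
  then have "(1, corner m (Suc i)) \<in>
      realize m Ceiling \<inter> realize m (Side i) \<inter> realize m (Side (Suc i mod m))"
    by (auto simp: c)
  then show ?thesis by blast
qed

section \<open>Alternating colorings encoded by the bit sequence of their bars\<close>

fun alternating :: "bit ^ 3 \<Rightarrow> bit ^ 3 \<Rightarrow> bit ^ 3 \<Rightarrow> (nat \<Rightarrow> bit) \<Rightarrow> coloring" where
  "alternating e \<alpha> \<beta> x (Side i) = (if even i then \<alpha> else \<beta>) + x i *s e"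
| "alternating e \<alpha> \<beta> x _ = e"

lemma coloring_C4_alternating:
  "coloring_C4 e \<alpha> \<beta> = alternating e \<alpha> \<beta> (\<lambda>i. if i = 0 then 1 else 0)"
proof
  show "coloring_C4 e \<alpha> \<beta> p = alternating e \<alpha> \<beta> (\<lambda>i. if i = 0 then 1 else 0) p" for p
    by (cases p) auto
qed

definition flip :: "nat set \<Rightarrow> (nat \<Rightarrow> bit) \<Rightarrow> nat \<Rightarrow> bit" where
  "flip S x = (\<lambda>i. if i \<in> S then x i + 1 else x i)"

lemma flip_flip: "flip T (flip S x) = flip (sym_diff S T) x"
  by (auto simp: flip_def fun_eq_iff add.assoc)

text \<open>For \<open>k\<close> and \<open>l\<close> of equal parity, these are the sides that
  \<open>O21\<close> changes in the block from \<open>k\<close> to \<open>l\<close> of an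
  alternating coloring.\<close>

definition between :: "nat \<Rightarrow> nat \<Rightarrow> nat set" where
  "between k l = {i. k < i \<and> i < l \<and> even i \<noteq> even k}"


section \<open>Linear maps and change of basis\<close>

lemma bit_linear_eqI:
  fixes f g :: "bit ^ 3 \<Rightarrow> bit ^ 3"
  assumes "Vector_Spaces.linear (*s) (*s) f" "Vector_Spaces.linear (*s) (*s) g"
    and "vec.span B = UNIV" "\<And>x. x \<in> B \<Longrightarrow> f x = g x"
  shows "f = g"
  using vec.linear_eq_on_span[OF assms(1,2), of B] assms(3,4) by auto

lemma span_independent_triple:
  assumes "distinct [u, v, w]" "vec.independent {u, v, w :: bit ^ 3}"
  shows "vec.span {u, v, w} = UNIV"
proof -
  have "vec.dim {u, v, w} = 3"
    using vec.dim_eq_card_independent[OF assms(2)] assms(1) by simp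
  then show ?thesis
    using vec.dim_eq_full[of "{u, v, w}"] vec_dim_card[where 'a = bit and 'n = 3]
    by (simp add: vec.dimension_def del: vec_dim_card)
qed

text \<open>The assignment and its inverse both extend linearly, and the two composites fix a basis,
  hence are the identity. The resulting bijections feed the rule \<open>DJ\<close>.\<close>

lemma basis_change:
  assumes u: "distinct [u1, u2, u3]" "vec.independent {u1, u2, u3 :: bit ^ 3}"
    and v: "distinct [v1, v2, v3]" "vec.independent {v1, v2, v3 :: bit ^ 3}"
  obtains \<sigma> where "Vector_Spaces.linear (*s) (*s) \<sigma>" "bij \<sigma>" "\<sigma> u1 = v1" "\<sigma> u2 = v2" "\<sigma> u3 = v3"
proof -
  have ex: "\<exists>\<sigma>. Vector_Spaces.linear (*s) (*s) \<sigma> \<and> \<sigma> a1 = b1 \<and> \<sigma> a2 = b2 \<and> \<sigma> a3 = b3"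
    if "distinct [a1, a2, a3]" "vec.independent {a1, a2, a3}" for a1 a2 a3 b1 b2 b3 :: "bit ^ 3"
    using vec.linear_independent_extend[OF that(2), of "\<lambda>x. if x = a1 then b1 else if x = a2 then b2 else b3"]
      that(1) by auto
  obtain \<sigma> where \<sigma>: "Vector_Spaces.linear (*s) (*s) \<sigma>" "\<sigma> u1 = v1" "\<sigma> u2 = v2" "\<sigma> u3 = v3"
    using ex[OF u] by blast
  obtain \<tau> where \<tau>: "Vector_Spaces.linear (*s) (*s) \<tau>" "\<tau> v1 = u1" "\<tau> v2 = u2" "\<tau> v3 = u3"
    using ex[OF v] by blast
  have "\<tau> \<circ> \<sigma> = id"
    by (rule bit_linear_eqI[OF _ _ span_independent_triple[OF u]])
       (use \<sigma> \<tau> in \<open>auto simp: vec.linear_id intro: Vector_Spaces.linear_compose\<close>)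
  moreover have "\<sigma> \<circ> \<tau> = id"
    by (rule bit_linear_eqI[OF _ _ span_independent_triple[OF v]])
       (use \<sigma> \<tau> in \<open>auto simp: vec.linear_id intro: Vector_Spaces.linear_compose\<close>)
  ultimately have "bij \<sigma>" using o_bij by blast
  then show ?thesis using \<sigma> that by blast
qed

section \<open>Alternating colorings of an even prism are trivial colorings\<close>

locale even_prism =
  fixes e \<alpha> \<beta> :: "bit ^ 3" and m :: nat
  assumes indep: "\<beta> \<noteq> 0" "\<alpha> \<notin> {0, \<beta>}" "e \<notin> {0, \<alpha>, \<beta>, \<alpha> + \<beta>}"
    and even_m: "even m" and m_ge: "m \<ge> 4"
begin

abbreviation "alt \<equiv> alternating e \<alpha> \<beta>"

text \<open>Adding \<open>e\<close> to the other members of a basis containing \<open>e\<close>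
  gives a basis again, so bars do not affect independence.\<close>

lemma barred_triple:
  assumes "a \<in> {\<alpha>, \<alpha> + e}" "b \<in> {\<beta>, \<beta> + e}"
  shows "b \<noteq> 0 \<and> a \<notin> {0, b} \<and> e \<notin> {0, a, b, a + b}"
proof -
  have "\<alpha> + e \<noteq> \<beta>" "\<beta> + e \<noteq> \<alpha>" "\<beta> + e \<noteq> 0" "\<alpha> + e \<noteq> 0" "\<alpha> + \<beta> \<noteq> 0" "e + (\<alpha> + \<beta>) \<noteq> 0"
    using indep by (auto simp: add_eq_iff_bit_vec)
  then show ?thesis using assms indep by (elim insertE emptyE) simp_all
qed

lemma barred_independent:
  assumes "a \<in> {\<alpha>, \<alpha> + e}" "b \<in> {\<beta>, \<beta> + e}"
  shows "distinct [a, b, e] \<and> vec.independent {a, b, e}"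
  using barred_triple[OF assms] independent_triple_bit_vec by blast

lemma alt_Side:
  "even i \<Longrightarrow> alt x (Side i) \<in> {\<alpha>, \<alpha> + e}"
  "odd i \<Longrightarrow> alt x (Side i) \<in> {\<beta>, \<beta> + e}"
  by (cases "x i"; simp)+

lemma alt_flip_Side: "alt (flip S x) (Side i) = alt x (Side i) + (if i \<in> S then e else 0)"
  by (cases "x i") (auto simp: flip_def add.assoc)

lemma alt_independent_colors:
  assumes "even i" "odd j" "X \<in> {Ceiling, Floor}"
  shows "independent_colors (alt x) {Side i, Side j, X}"
proof -
  have "alt x X = e" "i \<noteq> j" using assms by auto
  then show ?thesis
    using assms barred_independent[OF alt_Side(1)[OF assms(1)] alt_Side(2)[OF assms(2)]]
    by (subst independent_colors_triple) auto
qed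

lemma trivial_coloring_alt: "trivial_coloring m (alt x)"
  unfolding trivial_coloring_def is_coloring_def
proof (intro conjI allI impI)
  \<comment> \<open>Two sides of the same parity do not meet, so \<open>F\<close> has at most one side of each parity.\<close>
  fix F assume F: "F \<subseteq> facets m" "(\<Inter>p\<in>F. realize m p) \<noteq> {}"
  have meet: "realize m p \<inter> realize m q \<noteq> {}" if "p \<in> F" "q \<in> F" for p q
    using F(2) that by blast
  \<comment> \<open>Ceiling and floor are disjoint, so \<open>F\<close> contains at most one of
    them.\<close>
  obtain X where X: "X \<in> {Ceiling, Floor}" "F \<inter> {Ceiling, Floor} \<subseteq> {X}"
    using meet[of Ceiling Floor] by fastforce
  have "\<exists>i. even i = P \<and> (\<forall>k. Side k \<in> F \<and> even k = P \<longrightarrow> k = i)" for P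
  proof (cases "\<exists>i. Side i \<in> F \<and> even i = P")
    case True
    then obtain i where i: "Side i \<in> F" "even i = P" by blast
    have "k = i" if "Side k \<in> F" "even k = P" for k
      using realize_Side_disjoint[OF even_m, of k i] meet[OF that(1) i(1)] F(1) i that
      by (auto simp: facets_def)
    then show ?thesis using i by blast
  next
    case False
    \<comment> \<open>If \<open>F\<close> has no side of this parity, any index of that parity
      serves; 0 and 1 are the defaults.\<close>
    then show ?thesis by (cases P) (auto intro: exI[of _ "0::nat"] exI[of _ "1::nat"])
  qed
  from this[of True] this[of False] obtain i j where
    ij: "even i" "odd j" "\<And>k. Side k \<in> F \<Longrightarrow> k = i \<or> k = j"
    by metis
  have "F \<subseteq> {Side i, Side j, X}"
  proof
    fix p assume "p \<in> F"
    then show "p \<in> {Side i, Side j, X}" using ij(3) X(2) by (cases p) auto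
  qed
  then show "independent_colors (alt x) F"
    using alt_independent_colors[OF ij(1,2) X(1)] independent_colors_mono by blast
qed simp

text \<open>Modulo \<open>e\<close> the span contains only one nonzero letter, that of side
  \<open>k\<close>. This turns the case distinction of \<open>O21\<close> into a test of
  parity.\<close>

lemma alt_in_span_iff:
  "alt x (Side i) \<in> vec.span {e, alt x (Side k)} \<longleftrightarrow> (even i \<longleftrightarrow> even k)"
proof -
  have same: "alt x (Side i) \<in> {alt x (Side k), e + alt x (Side k)}" if "even i \<longleftrightarrow> even k"
    using that by (cases "x i"; cases "x k") (simp_all add: add.left_commute add.commute[of e])
  have "a \<notin> {0, e, b, e + b}" "b \<notin> {0, e, a, e + a}"
    if "a \<in> {\<alpha>, \<alpha> + e}" "b \<in> {\<beta>, \<beta> + e}" for a b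
    using barred_triple[OF that] by (auto simp: ac_simps)
  then have "alt x (Side i) \<notin> {0, e, alt x (Side k), e + alt x (Side k)}"
    if "\<not> (even i \<longleftrightarrow> even k)"
    using that alt_Side[of i x] alt_Side[of k x] by metis
  with same show ?thesis
    unfolding span_pair_bit_vec by blast
qed

section \<open>Moves as operations on bit sequences\<close>

definition reach :: "(nat \<Rightarrow> bit) \<Rightarrow> (nat \<Rightarrow> bit) \<Rightarrow> bool" where
  "reach x y \<longleftrightarrow> sector_equivalent m (alt x) (alt y)"

lemma reach_trans [trans]: "reach x y \<Longrightarrow> reach y z \<Longrightarrow> reach x z"
  unfolding reach_def sector_equivalent_def by (rule equivclp_trans)

lemma reach_move: "sector_move m (alt x) (alt y) \<Longrightarrow> reach x y"
  unfolding reach_def sector_equivalent_def sector_step_def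
  by (intro r_into_equivclp) (simp add: trivial_coloring_alt)

text \<open>The identity is a \<open>DJ\<close> move, and \<open>DJ\<close> constrains the new
  coloring only on \<open>facets m\<close>, so bits from position \<open>m\<close> on are
  irrelevant.\<close>

lemma reach_cong: "(\<And>i. i < m \<Longrightarrow> x i = y i) \<Longrightarrow> reach x y"
  by (rule reach_move, rule sector_move.DJ[of id]) (auto simp: facets_def vec.linear_id)

text \<open>Equal parity with different bits means that the two colors differ by \<open>e\<close>,
  which is the premise of \<open>O21\<close>.\<close>

lemma reach_flip_between:
  assumes "k < l" "l < m" "even k \<longleftrightarrow> even l" "x k \<noteq> x l"
  shows "reach x (flip (between k l) x)"
proof (rule reach_move, rule sector_move.O21[of _ k l])
  show "alt x (Side k) = alt x (Side l) + alt x Ceiling"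
    using assms by (cases "x k"; cases "x l") (simp_all add: add.assoc)
  let ?g = "\<lambda>i. if alt x (Side i) \<in> vec.span {alt x Ceiling, alt x (Side k)} then alt x (Side i)
      else alt x (Side i) + alt x Ceiling"
  have "alt (flip (between k l) x) (Side i) = (if k \<le> i \<and> i \<le> l then ?g i else alt x (Side i))" for i
  proof -
    have "i \<in> between k l \<longleftrightarrow> k \<le> i \<and> i \<le> l \<and> (even i \<noteq> even k)"
      using assms(3) by (auto simp: between_def le_less)
    then show ?thesis
      unfolding alt_flip_Side alternating.simps(2) alt_in_span_iff
      by (simp del: alternating.simps(1))
  qed
  then show "change_block m k l (alt x) ?g (alt (flip (between k l) x))"
    unfolding change_block_def recolor_sides_def using assms(1,2) by simp
qed

text \<open>The shear that adds \<open>e\<close> to one letter and fixes \<open>e\<close> and the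
  other letter is bijective, so one \<open>DJ\<close> move toggles the bars of a whole parity
  class.\<close>

lemma reach_flip_parity: "reach x (flip {i. even i = P} x)"
proof -
  let ?a = "if P then \<alpha> + e else \<alpha>" and ?b = "if P then \<beta> else \<beta> + e"
  have "distinct [\<alpha>, \<beta>, e]" "vec.independent {\<alpha>, \<beta>, e}"
    "distinct [?a, ?b, e]" "vec.independent {?a, ?b, e}"
    using barred_independent[of \<alpha> \<beta>] barred_independent[of ?a ?b] by auto
  then obtain \<sigma> where \<sigma>: "Vector_Spaces.linear (*s) (*s) \<sigma>" "bij \<sigma>" "\<sigma> \<alpha> = ?a" "\<sigma> \<beta> = ?b" "\<sigma> e = e"
    by (rule basis_change)
  have "alt (flip {i. even i = P} x) p = \<sigma> (alt x p)" for p
  proof (cases p)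
    case (Side i)
    have "\<sigma> (alt x (Side i)) = (if even i then ?a else ?b) + x i *s e"
      using \<sigma>(3-5) by (simp add: vec.linear_add[OF \<sigma>(1)] vec.linear_scale[OF \<sigma>(1)])
    then show ?thesis
      unfolding Side alt_flip_Side by (cases P) (simp_all add: ac_simps)
  qed (use \<sigma>(5) in simp_all)
  then show ?thesis
    using \<sigma> by (intro reach_move sector_move.DJ) auto
qed

text \<open>If \<open>u\<close> and \<open>v\<close> carry equal bits, \<open>k\<close> differs from
  both. The flips between \<open>k\<close> and each of them combine to the flip between
  \<open>u\<close> and \<open>v\<close>, and the first leaves the bits that the second depends on
  unchanged.\<close>

lemma reach_flip_between_nonconstant:
  assumes "u < v" "v < m" "even u = even v"
    and "k < m" "even k = even u" "x k \<noteq> x u"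
  shows "reach x (flip (between u v) x)"
proof (cases "x u = x v")
  case False
  then show ?thesis using assms reach_flip_between by blast
next
  case True
  note * = assms True
  have fixed: "flip (between i j) x l = x l" if "even i = even l" for i j l
    using that by (simp add: flip_def between_def)
  have twice: "reach x (flip T (flip S x))"
    if "reach x (flip S x)" "reach (flip S x) (flip T (flip S x))" for S T
    using that reach_trans by blast
  consider "k < u" | "u < k" "k < v" | "v < k"
    using * by (metis linorder_neqE_nat)
  then show ?thesis
  proof cases
    case 1
    have "flip (between k v) (flip (between k u) x) = flip (between u v) x"
      unfolding flip_flip by (rule arg_cong[where f = "\<lambda>S. flip S x"])
        (use * 1 in \<open>auto simp: between_def linorder_neq_iff linorder_not_less le_less\<close>)
    moreover have "reach x (flip (between k u) x)"
      using * 1 by (intro reach_flip_between) auto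
    moreover have "reach (flip (between k u) x) (flip (between k v) (flip (between k u) x))"
      using * 1 by (intro reach_flip_between) (auto simp: fixed)
    ultimately show ?thesis using twice by metis
  next
    case 2
    \<comment> \<open>Here the two sets are disjoint; in the outer cases one contains the other and
      the overlap cancels. The dividing position has the wrong parity to be in any of them.\<close>
    have "flip (between k v) (flip (between u k) x) = flip (between u v) x"
      unfolding flip_flip by (rule arg_cong[where f = "\<lambda>S. flip S x"])
        (use * 2 in \<open>auto simp: between_def linorder_neq_iff linorder_not_less le_less\<close>)
    moreover have "reach x (flip (between u k) x)"
      using * 2 by (intro reach_flip_between) auto
    moreover have "reach (flip (between u k) x) (flip (between k v) (flip (between u k) x))"
      using * 2 by (intro reach_flip_between) (auto simp: fixed)
    ultimately show ?thesis using twice by metis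
  next
    case 3
    have "flip (between v k) (flip (between u k) x) = flip (between u v) x"
      unfolding flip_flip by (rule arg_cong[where f = "\<lambda>S. flip S x"])
        (use * 3 in \<open>auto simp: between_def linorder_neq_iff linorder_not_less le_less\<close>)
    moreover have "reach x (flip (between u k) x)"
      using * 3 by (intro reach_flip_between) auto
    moreover have "reach (flip (between u k) x) (flip (between v k) (flip (between u k) x))"
      using * 3 by (intro reach_flip_between) (auto simp: fixed)
    ultimately show ?thesis using twice by metis
  qed
qed

text \<open>The two neighbors of an inner position enclose just that position; the two end positions
  need a separate argument.\<close>

lemma reach_flip_single:
  assumes "k < m" "l < m" "even k = even l" "x k \<noteq> x l" and p: "p < m" "even p \<noteq> even k"
  shows "reach x (flip {p} x)"
proof -
  have btw: "reach x (flip (between u v) x)" if "u < v" "v < m" "even u = even k" "even v = even k" for u v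
  proof -
    \<comment> \<open>The bits at \<open>k\<close> and \<open>l\<close> differ, so one of them
      differs from the bit at \<open>u\<close>.\<close>
    obtain j where "j \<in> {k, l}" "x j \<noteq> x u" using assms(4) by (metis insertCI)
    then show ?thesis
      using that assms(1-3) by (intro reach_flip_between_nonconstant[of u v j]) auto
  qed
  show ?thesis
  proof (cases "p = 0 \<or> p = m - 1")
    case False
    with p have "p + 1 < m" "p > 0" by linarith+
    moreover from this have "between (p - 1) (p + 1) = {p}"
      by (auto simp: between_def)
    ultimately show ?thesis
      using btw[of "p - 1" "p + 1"] p by auto
  next
    \<comment> \<open>The two end positions lie between no two sides: flip the rest of the parity class,
      then the whole class.\<close>
    case True
    \<comment> \<open>These are the first and last sides of the parity opposite to
      \<open>p\<close>.\<close>
    define u v where "u = (if p = 0 then 1 else 0 :: nat)" and "v = (if p = 0 then m - 1 else m - 2)"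
    have uv: "u < v" "v < m" "even u = even k" "even v = even k"
      using True p even_m m_ge by (auto simp: u_def v_def)
    have "reach x (flip (between u v) x)" using btw uv by blast
    also have "reach \<dots> (flip {i. even i = even p} (flip (between u v) x))"
      by (rule reach_flip_parity)
    also have "reach \<dots> (flip {p} x)"
    proof (rule reach_cong)
      fix i assume "i < m"
      have "i \<in> sym_diff (between u v) {i. even i = even p} \<longleftrightarrow> i = p"
      proof (cases "p = 0")
        case True
        with \<open>i < m\<close> even_m show ?thesis
          unfolding u_def v_def between_def by simp presburger
      next
        case False
        with \<open>p = 0 \<or> p = m - 1\<close> m_ge have "m = Suc p" by linarith
        with \<open>i < m\<close> even_m False show ?thesis
          unfolding u_def v_def between_def by simp presburger
      qed
      then show "flip {i. even i = even p} (flip (between u v) x) i = flip {p} x i"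
        unfolding flip_flip by (simp only: flip_def singleton_iff)
    qed
    finally show ?thesis .
  qed
qed

text \<open>The positions where \<open>x\<close> and \<open>y\<close> disagree are flipped one by
  one. They avoid the parity of \<open>k\<close> and \<open>l\<close>, whose differing bits
  therefore stay available for every flip.\<close>

lemma reach_other_parity:
  assumes "k < m" "l < m" "even k = even l" "x k \<noteq> x l"
    and eq: "\<And>i. i < m \<Longrightarrow> even i = even k \<Longrightarrow> y i = x i"
  shows "reach x y"
proof -
  have "reach x (flip S x)" if "finite S" "S \<subseteq> {i. i < m \<and> even i \<noteq> even k}" for S
    using that
  proof (induction S rule: finite_induct)
    case empty
    then show ?case by (simp add: flip_def reach_cong)
  next
    case (insert p S)
    then have "reach x (flip S x)" by simp
    also have "reach \<dots> (flip {p} (flip S x))"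
    proof (rule reach_flip_single[of k l])
      have "k \<notin> S" "l \<notin> S" using insert.prems assms(3) by auto
      then show "flip S x k \<noteq> flip S x l" using assms(4) by (simp add: flip_def)
    qed (use insert.prems assms in auto)
    also have "flip {p} (flip S x) = flip (insert p S) x"
      using insert.hyps by (auto simp: flip_def)
    finally show ?case .
  qed
  moreover have "{i. i < m \<and> x i \<noteq> y i} \<subseteq> {i. i < m \<and> even i \<noteq> even k}"
  proof
    fix i assume "i \<in> {i. i < m \<and> x i \<noteq> y i}"
    then have "i < m" "x i \<noteq> y i" by blast+
    then show "i \<in> {i. i < m \<and> even i \<noteq> even k}" using eq[of i] by (intro CollectI conjI notI) simp_all
  qed
  ultimately have "reach x (flip {i. i < m \<and> x i \<noteq> y i} x)"
    by simp
  also have "reach \<dots> y"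
  proof (rule reach_cong)
    fix i assume "i < m"
    then show "flip {i. i < m \<and> x i \<noteq> y i} x i = y i"
      by (cases "x i"; cases "y i") (simp_all add: flip_def)
  qed
  finally show ?thesis .
qed

lemma reach_C4:
  assumes "k < m" "l < m" "even k = even l" "x k \<noteq> x l"
  shows "reach x (\<lambda>i. if i = 0 then 1 else 0)"
proof -
  have odd_nonconst: "reach x (\<lambda>i. if i = 0 then 1 else 0)"
    if kl: "k < m" "l < m" "odd k" "odd l" "x k \<noteq> x l" for x k l
  proof -
    \<comment> \<open>The even bits of \<open>y\<close> are already the desired ones, and they
      differ at 0 and 2, which permits clearing the odd bits afterwards.\<close>
    define y where "y i = (if i = 0 then 1 else if even i then 0 else x i)" for i
    have "reach x y"
      using kl by (intro reach_other_parity[of k l]) (auto simp: y_def)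
    also have "reach y (\<lambda>i. if i = 0 then 1 else 0)"
      using m_ge by (intro reach_other_parity[of 0 2]) (auto simp: y_def)
    finally show ?thesis .
  qed
  show ?thesis
  proof (cases "even k")
    case False
    then show ?thesis using odd_nonconst assms by auto
  next
    case True
    \<comment> \<open>The odd bits are made to differ at 1 and 3, which reduces to the previous
      case.\<close>
    define y where "y i = (if i = 1 then 1 else if odd i then 0 else x i)" for i
    have "reach x y"
      using True assms by (intro reach_other_parity[of k l]) (auto simp: y_def)
    also have "reach y (\<lambda>i. if i = 0 then 1 else 0)"
      using m_ge by (intro odd_nonconst[of 1 3]) (auto simp: y_def)
    finally show ?thesis .
  qed
qed

end

section \<open>From an arbitrary coloring to an alternating one\<close>

lemma is_coloring_adjacent:
  assumes "is_coloring m col" "i < m" "m \<ge> 2"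
  shows "col Ceiling \<noteq> 0 \<and> col (Side i) \<notin> {0, col Ceiling} \<and>
    col (Side (Suc i mod m)) \<notin> {0, col (Side i), col Ceiling, col (Side i) + col Ceiling}"
proof -
  let ?j = "Suc i mod m"
  have "?j \<noteq> i" using assms by (cases "Suc i = m") auto
  moreover have "{Ceiling, Side i, Side ?j} \<subseteq> facets m"
    using assms by (simp add: facets_def)
  then have "independent_colors col {Ceiling, Side i, Side ?j}"
    using assms(1) adjacent_facets_meet[OF assms(2)]
    unfolding is_coloring_def by (metis (no_types, lifting) INT_insert Int_assoc Int_UNIV_right INT_empty)
  then have "independent_colors col {Side i, Ceiling, Side ?j}"
    by (simp add: insert_commute)
  ultimately show ?thesis
    using independent_colors_triple[of "Side i" Ceiling "Side ?j" col]
      independent_triple_bit_vec[of "col (Side i)" "col Ceiling" "col (Side ?j)"]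
    by auto
qed

theorem proposition5p3:
  fixes m :: nat and col :: coloring and e1 \<alpha> \<beta> :: "bit ^ 3"
  assumes "m \<ge> 3"
    and "is_basis e1 \<alpha> \<beta>"
    and "trivial_coloring m col"
    and "col Ceiling = e1" and "col Floor = e1"
    and "three_independent m col"
    and "\<not> property_star e1 \<alpha> \<beta> m col"
  shows "even m \<and> sector_equivalent m col (coloring_C4 e1 \<alpha> \<beta>)"
proof -
  define L where "L i = col (Side i)" for i
  define u v where "u = L 0" and "v = L 1"
  have adj: "L i \<notin> {0, e1}" "L (Suc i mod m) \<notin> {0, L i, e1, L i + e1}" if "i < m" for i
  proof -
    have "is_coloring m col" "m \<ge> 2" using assms(1,3) by (simp_all add: trivial_coloring_def)
    from is_coloring_adjacent[OF this(1) that this(2)]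
    show "L i \<notin> {0, e1}" "L (Suc i mod m) \<notin> {0, L i, e1, L i + e1}"
      unfolding L_def assms(4) by blast+
  qed
  have adj_Suc: "L (Suc i) \<notin> {L i, L i + e1}" if "Suc i < m" for i
    using adj(2)[of i] that by simp
  have basis: "distinct [\<alpha>, \<beta>, e1]" "vec.independent {\<alpha>, \<beta>, e1}"
    using assms(2) by (auto simp: is_basis_def insert_commute)
  have "e1 \<noteq> 0" "v \<noteq> 0" "u \<notin> {0, v}" "e1 \<notin> {0, u, v, u + v}"
    using basis vec.dependent_zero[of "{\<alpha>, \<beta>, e1}"] adj[of 0] assms(1)
    by (auto simp: u_def v_def ac_simps)
  then have uv: "distinct [u, v, e1]" "vec.independent {u, v, e1}"
    using independent_triple_bit_vec[of u v e1] by blast+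
  \<comment> \<open>Failure of the property yields a letter \<open>z\<close> that occurs neither
    plain nor barred.\<close>
  obtain z where z: "z \<in> {\<alpha>, \<beta>, \<alpha> + \<beta>}" "\<And>i. i < m \<Longrightarrow> L i \<notin> {z, z + e1}"
    using assms(7) by (auto simp: property_star_def L_def)
  have nonzero: "\<beta> \<noteq> 0" "\<alpha> \<notin> {0, \<beta>}" "e1 \<notin> {0, \<alpha>, \<beta>, \<alpha> + \<beta>}"
    using basis independent_triple_bit_vec[of \<alpha> \<beta> e1] by blast+
  then have z_nonzero: "z \<notin> {0, e1}"
    using z(1) by (auto simp: add_eq_iff_bit_vec)
  have UNIV: "y \<in> {0, u, v, e1, u + v, u + e1, v + e1, u + v + e1}" for y
    using span_independent_triple[OF uv] span_triple_bit_vec[of u v e1] by blast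
  \<comment> \<open>The letters of \<open>u\<close> and \<open>v\<close> occur on sides 0 and 1, so
    modulo \<open>e1\<close> the missing letter is their sum.\<close>
  have "z \<in> {u + v, u + v + e1}"
    using UNIV[of z] z_nonzero z(2)[of 0] z(2)[of 1] assms(1)
    by (auto simp: u_def v_def add.assoc)
  then have letters: "L i \<in> {u, u + e1, v, v + e1}" if "i < m" for i
    using UNIV[of "L i"] z(2)[OF that] adj(1)[OF that] by (auto simp: add.assoc)
  have alternate: "i < m \<Longrightarrow> L i \<in> (if even i then {u, u + e1} else {v, v + e1})" for i
  proof (induction i)
    case 0
    then show ?case by (simp add: u_def)
  next
    case (Suc i)
    then have "L i \<in> (if even i then {u, u + e1} else {v, v + e1})" by simp
    with letters[OF Suc.prems] adj_Suc[OF Suc.prems] show ?case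
      by (cases "even i") (auto simp: add.assoc)
  qed
  have "even m"
  proof (rule ccontr)
    assume "odd m"
    \<comment> \<open>For odd \<open>m\<close> the last side would carry the same letter as its
      cyclic neighbor, side 0.\<close>
    then have "L (m - 1) \<in> {u, u + e1}"
      using alternate[of "m - 1"] assms(1) by simp
    then show False
      using adj(2)[of "m - 1"] assms(1) by (auto simp: u_def add.assoc)
  qed
  with \<open>m \<ge> 3\<close> have "m \<ge> 4" by presburger
  then interpret even_prism e1 \<alpha> \<beta> m
    using nonzero \<open>even m\<close> by unfold_locales
  obtain \<sigma> where \<sigma>: "Vector_Spaces.linear (*s) (*s) \<sigma>" "bij \<sigma>" "\<sigma> u = \<alpha>" "\<sigma> v = \<beta>" "\<sigma> e1 = e1"
    using basis_change[OF uv basis] .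
  \<comment> \<open>Bars are measured relative to \<open>u\<close> and \<open>v\<close>, which
    \<open>\<sigma>\<close> sends to the plain letters; positions 0 and 1 thus have bit 0.\<close>
  define x :: "nat \<Rightarrow> bit" where "x i = (if L i \<in> {u, v} then 0 else 1)" for i
  have L_eq: "L i = (if even i then u else v) + x i *s e1" if "i < m" for i
    using alternate[OF that] uv \<open>e1 \<notin> {0, u, v, u + v}\<close>
    by (auto simp: x_def split: if_splits)
  have "sector_move m col (alt x)"
  proof (rule sector_move.DJ[OF \<sigma>(1,2)], rule ballI)
    fix p assume "p \<in> facets m"
    then show "alt x p = \<sigma> (col p)"
      using \<sigma>(3-5) assms(4,5) L_eq
      by (auto simp: facets_def vec.linear_add[OF \<sigma>(1)] vec.linear_scale[OF \<sigma>(1)]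
          simp flip: L_def)
  qed
  then have "sector_step m col (alt x)"
    using assms(3) trivial_coloring_alt by (simp add: sector_step_def)
  moreover have "\<exists>k<m. \<exists>l<m. even k = even l \<and> x k \<noteq> x l"
  proof (rule ccontr)
    \<comment> \<open>With bits constant on both parity classes every side has the color of side 0
      or 1, so the side colors span a plane, against 3-independence.\<close>
    assume const: "\<not> ?thesis"
    have "L i \<in> {u, v}" if "i < m" for i
    proof -
      define r :: nat where "r = (if even i then 0 else 1)"
      have r: "r < m" "even i = even r" using \<open>m \<ge> 4\<close> by (auto simp: r_def)
      then have "x i = x r" using const that by metis
      then have "L i = L r"
        using L_eq[OF that] L_eq[OF r(1)] r(2) by simp
      then show ?thesis by (auto simp: r_def u_def v_def)
    qed
    then have "col ` Side ` {..<m} = {u, v}"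
      using \<open>m \<ge> 4\<close> by (force simp: u_def v_def L_def)
    moreover have "vec.dim (vec.span {u, v}) = 2"
      using vec.dim_eq_card_independent[OF vec.independent_mono[OF uv(2), of "{u, v}"]] uv(1)
      by auto
    ultimately show False
      using assms(6) by (simp add: three_independent_def two_independent_def)
  qed
  then have "sector_equivalent m (alt x) (coloring_C4 e1 \<alpha> \<beta>)"
    using reach_C4 by (auto simp: reach_def coloring_C4_alternating)
  ultimately show ?thesis
    using \<open>even m\<close> unfolding sector_equivalent_def
    by (meson equivclp_trans r_into_equivclp)
qed

end
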